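(* Let $D, V, A$ be real constants with $D>0$ and $V\neq 0$, let $\rho>0$ be the time step, let $h>0$ be the step of the uniform grid $\{\tau_i\}$, and let $0<\mu<h$ be the shift between the two spatial grids, $\tau_i-x_i=\mu$. Consider the three-point difference scheme $$\alpha\varphi^{k+1}_{\tau_{i-1}}-\gamma\varphi^{k+1}_{\tau_i}+\beta\varphi^{k+1}_{\tau_{i+1}}=-\frac{f^{k+1}_{x_i}+f^{k+1}_{x_{i+1}}}{2}-\frac{u^k_{x_{i+1}}+u^k_{x_i}}{2\rho},\qquad i=1,\dots,N-2,$$ where $$\alpha=a-\frac{\mu^2}{2h^2}\left(\frac1\rho-A\right),\qquad \beta=b-\frac{(h-\mu)^2}{2h^2}\left(\frac1\rho-A\right),$$ $$\gamma=a+b+\frac{2h^2-\mu^2-(h-\mu)^2}{2h^2}\left(\frac1\rho-A\right),$$ $$a=\frac{D}{h^2}+\frac{V}{h^2}\mu,\qquad b=\frac{D}{h^2}-\frac{V}{h}\left(1-\frac{\mu}{h}\right).$$ Set $$\rho_1=\frac{\mu^2}{2(D+V\mu)+A\mu^2},\qquad \rho_2=\frac{(h-\mu)^2}{2(D+V\mu-Vh)+A(h-\mu)^2}.$$ If $\rho>\max(\rho_1,\rho_2)$ and, in the case $A>0$, also $\rho\le \frac1A$, then the difference scheme is monotone, i.e. $\alpha>0$, $\beta>0$ and $\gamma\ge\alpha+\beta$.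
   Context: The scheme approximates the boundary value problem for the convection-diffusion-reaction equation $\frac{\partial u}{\partial t}=D\frac{\partial^2 u}{\partial x^2}-V\frac{\partial u}{\partial x}+Au+f(x,t)$, $x\in(0,L)$, $t>0$, with $u(0,t)=U_0(t)$, $u(L,t)=U_L(t)$, $u(x,0)=g(x)$, where the coefficients $D,V,A$ are taken constant, $V\ne0$, and $D>0$ is (informally) a small parameter, $0<D\ll1$. Time is discretized by $t_{k+1}=t_k+\rho$, $t_0=0$, with constant step $\rho$. On $[0,L]$ there are two grids: $0=x_0<x_1<\dots<x_N=L$ and $0=\tau_0<\tau_1<\dots<\tau_{N-1}=L$, with $x_i<\tau_i<x_{i+1}$ for $i=1,\dots,N-2$. The grid $\{\tau_i\}$ is uniform with step $h$, and the grid $\{x_i\}$ is placed so that $\tau_i-x_i=\mu$ (hence $0<\mu<h$). The unknowns $\varphi^{k+1}_{\tau_i}$ are the values of the grid function at the nodes $\tau_i$ at time $t_{k+1}$; $f^{k+1}_{x_i}=f(x_i,t_{k+1})$; $u^k_{x_i}$ are the values at the nodes $x_i$ at the previous time $t_k$. A three-point difference scheme of the form $\alpha\varphi_{i-1}-\gamma\varphi_i+\beta\varphi_{i+1}=F_i$ is called monotone if its coefficients satisfy $\alpha>0$, $\beta>0$ and $\gamma\ge\alpha+\beta$.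
   Formalization: The thresholds ρ_1 and ρ_2 are additionally assumed positive (positive denominators); without this the claim fails, e.g. D=1, V=−4, A=0, h=1, μ=1/2, ρ=1 gives ρ_1=−1/8, ρ_2=1/24 but α<0. *)

theory Defs
  imports Complex_Main
begin

text \<open>
  A three-point difference scheme with constant coefficients \<open>\<alpha>\<close>, \<open>\<gamma>\<close>, \<open>\<beta>\<close>,
  imposed at the indices \<open>i\<close> of a set of nodes:
  \<open>\<alpha> \<phi>(i-1) - \<gamma> \<phi>(i) + \<beta> \<phi>(i+1) = F(i)\<close>.
\<close>

record three_point_scheme =
  coeff_lower :: real   (* alpha *)
  coeff_centre :: real  (* gamma, entering the equation with a minus sign *)
  coeff_upper :: real   (* beta *)
  rhs :: "nat \<Rightarrow> real"   (* F *)
  nodes :: "nat set"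

definition solves_scheme :: "three_point_scheme \<Rightarrow> (nat \<Rightarrow> real) \<Rightarrow> bool" where
  "solves_scheme S \<phi> \<longleftrightarrow>
     (\<forall>i \<in> nodes S.
        coeff_lower S * \<phi> (i - 1) - coeff_centre S * \<phi> i + coeff_upper S * \<phi> (i + 1) = rhs S i)"

definition monotone_scheme :: "three_point_scheme \<Rightarrow> bool" where
  "monotone_scheme S \<longleftrightarrow>
     coeff_lower S > 0 \<and> coeff_upper S > 0 \<and>
     coeff_centre S \<ge> coeff_lower S + coeff_upper S"

text \<open>
  The two spatial grids \<open>x\<^sub>0 < \<dots> < x\<^sub>N\<close> and \<open>\<tau>\<^sub>0 < \<dots> < \<tau>\<^sub>N\<^sub>-\<^sub>1\<close> on \<open>[0, L]\<close>.
  The shift condition \<open>\<tau>\<^sub>i - x\<^sub>i = \<mu>\<close> is imposed for \<open>1 \<le> i \<le> N - 1\<close>; it cannot hold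
  for \<open>i = 0\<close>, where both grids start at the left end point.
\<close>

definition shifted_grids ::
    "real \<Rightarrow> nat \<Rightarrow> real \<Rightarrow> real \<Rightarrow> (nat \<Rightarrow> real) \<Rightarrow> (nat \<Rightarrow> real) \<Rightarrow> bool" where
  "shifted_grids L N h \<mu> x \<tau> \<longleftrightarrow>
     0 < L \<and>
     x 0 = 0 \<and> x N = L \<and> (\<forall>i<N. x i < x (i + 1)) \<and>
     \<tau> 0 = 0 \<and> \<tau> (N - 1) = L \<and> (\<forall>i<N - 1. \<tau> i < \<tau> (i + 1)) \<and>
     (\<forall>i\<in>{1..N - 2}. x i < \<tau> i \<and> \<tau> i < x (i + 1)) \<and>
     (\<forall>i<N - 1. \<tau> (i + 1) - \<tau> i = h) \<and>
     (\<forall>i\<in>{1..N - 1}. \<tau> i - x i = \<mu>)"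

primrec time_level :: "real \<Rightarrow> nat \<Rightarrow> real" where
  "time_level \<rho> 0 = 0"
| "time_level \<rho> (Suc k) = time_level \<rho> k + \<rho>"

definition conv_a :: "real \<Rightarrow> real \<Rightarrow> real \<Rightarrow> real \<Rightarrow> real" where
  "conv_a D V h \<mu> = D / h\<^sup>2 + V / h\<^sup>2 * \<mu>"

definition conv_b :: "real \<Rightarrow> real \<Rightarrow> real \<Rightarrow> real \<Rightarrow> real" where
  "conv_b D V h \<mu> = D / h\<^sup>2 - V / h * (1 - \<mu> / h)"

text \<open>
  The scheme for the time step from level \<open>k\<close> to level \<open>k + 1\<close>. The function \<open>u k\<close> is only
  read at the nodes of the grid \<open>x\<close>; the unknown at index \<open>i\<close> is the value at \<open>\<tau>\<^sub>i\<close> at time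
  level \<open>k + 1\<close>.
\<close>

definition shifted_grid_scheme ::
    "real \<Rightarrow> real \<Rightarrow> real \<Rightarrow> real \<Rightarrow> real \<Rightarrow> real \<Rightarrow> nat \<Rightarrow> (nat \<Rightarrow> real) \<Rightarrow>
     (real \<Rightarrow> real \<Rightarrow> real) \<Rightarrow> (nat \<Rightarrow> real \<Rightarrow> real) \<Rightarrow> nat \<Rightarrow> three_point_scheme" where
  "shifted_grid_scheme D V A \<rho> h \<mu> N x f u k =
     \<lparr> coeff_lower = conv_a D V h \<mu> - \<mu>\<^sup>2 / (2 * h\<^sup>2) * (1 / \<rho> - A),
       coeff_centre = conv_a D V h \<mu> + conv_b D V h \<mu>
          + (2 * h\<^sup>2 - \<mu>\<^sup>2 - (h - \<mu>)\<^sup>2) / (2 * h\<^sup>2) * (1 / \<rho> - A),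
       coeff_upper = conv_b D V h \<mu> - (h - \<mu>)\<^sup>2 / (2 * h\<^sup>2) * (1 / \<rho> - A),
       rhs = (\<lambda>i. - (f (x i) (time_level \<rho> (k + 1)) + f (x (i + 1)) (time_level \<rho> (k + 1))) / 2
                  - (u k (x (i + 1)) + u k (x i)) / (2 * \<rho>)),
       nodes = {1..N - 2} \<rparr>"

text \<open>
  The thresholds are lower bounds for the time step and are meaningful only when positive, that is,
  when their denominators are positive. With a negative denominator the bound on \<open>\<rho>\<close> would be
  vacuous while the corresponding coefficient of the scheme is negative; with a zero denominator
  the threshold is \<open>0\<close> by the convention on division.
\<close>

definition rho1 :: "real \<Rightarrow> real \<Rightarrow> real \<Rightarrow> real \<Rightarrow> real" where
  "rho1 D V A \<mu> = \<mu>\<^sup>2 / (2 * (D + V * \<mu>) + A * \<mu>\<^sup>2)"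

definition rho2 :: "real \<Rightarrow> real \<Rightarrow> real \<Rightarrow> real \<Rightarrow> real \<Rightarrow> real" where
  "rho2 D V A h \<mu> = (h - \<mu>)\<^sup>2 / (2 * (D + V * \<mu> - V * h) + A * (h - \<mu>)\<^sup>2)"

end

theory Submission
  imports Defs
begin

text \<open>
  Both off-diagonal coefficients have the form \<open>(2 * p + A * m\<^sup>2 - m\<^sup>2 / \<rho>) / (2 * h\<^sup>2)\<close>, with
  \<open>m = \<mu>\<close>, \<open>p = D + V * \<mu>\<close> for \<open>\<alpha>\<close> and \<open>m = h - \<mu>\<close>, \<open>p = D + V * \<mu> - V * h\<close> for \<open>\<beta>\<close>;
  a positive threshold below \<open>\<rho>\<close> is exactly what makes the numerator positive.
\<close>

lemma off_diagonal_coeff_pos: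
  fixes p m A \<rho> h :: real
  assumes "\<rho> > 0" "h \<noteq> 0"
    and thr: "0 < m\<^sup>2 / (2 * p + A * m\<^sup>2)" "m\<^sup>2 / (2 * p + A * m\<^sup>2) < \<rho>"
  shows "p / h\<^sup>2 - m\<^sup>2 / (2 * h\<^sup>2) * (1 / \<rho> - A) > 0"
proof -
  \<comment> \<open>The numerator is a square, so a positive quotient forces a positive
    denominator.\<close>
  have den: "2 * p + A * m\<^sup>2 > 0"
    using thr(1) by (simp add: zero_less_divide_iff)
  \<comment> \<open>Since \<open>den\<close> fixes the sign, the threshold bound can be cleared of
    its denominator and then divided by \<rho>.\<close>
  have "m\<^sup>2 / \<rho> < 2 * p + A * m\<^sup>2"
    using thr(2) den \<open>\<rho> > 0\<close> by (simp add: pos_divide_less_eq mult.commute)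
  then have "(2 * p + A * m\<^sup>2 - m\<^sup>2 / \<rho>) / (2 * h\<^sup>2) > 0"
    using \<open>h \<noteq> 0\<close> by simp
  also have "(2 * p + A * m\<^sup>2 - m\<^sup>2 / \<rho>) / (2 * h\<^sup>2)
      = p / h\<^sup>2 - m\<^sup>2 / (2 * h\<^sup>2) * (1 / \<rho> - A)"
    using assms(1,2) by (simp add: field_simps)
  finally show ?thesis .
qed

lemma conv_a_eq: "conv_a D V h \<mu> = (D + V * \<mu>) / h\<^sup>2"
  by (simp add: conv_a_def add_divide_distrib)

lemma conv_b_eq: "h \<noteq> 0 \<Longrightarrow> conv_b D V h \<mu> = (D + V * \<mu> - V * h) / h\<^sup>2"
  by (simp add: conv_b_def field_simps power2_eq_square)

text \<open>The convective parts \<open>conv_a\<close> and \<open>conv_b\<close> cancel in the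
  difference, and the three weights of \<open>1 / \<rho> - A\<close> add up to 1. Diagonal dominance
  thus depends only on the time step and the reaction coefficient.\<close>

lemma shifted_grid_scheme_dominance:
  fixes D V A \<rho> h \<mu> :: real
  assumes "h \<noteq> 0" and S_def: "S = shifted_grid_scheme D V A \<rho> h \<mu> N x f u k"
  shows "coeff_centre S - (coeff_lower S + coeff_upper S) = 1 / \<rho> - A"
proof -
  have "coeff_centre S - (coeff_lower S + coeff_upper S)
      = ((2 * h\<^sup>2 - \<mu>\<^sup>2 - (h - \<mu>)\<^sup>2) / (2 * h\<^sup>2) + \<mu>\<^sup>2 / (2 * h\<^sup>2) + (h - \<mu>)\<^sup>2 / (2 * h\<^sup>2))
        * (1 / \<rho> - A)"
    by (simp add: S_def shifted_grid_scheme_def distrib_right)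
  also have "(2 * h\<^sup>2 - \<mu>\<^sup>2 - (h - \<mu>)\<^sup>2) / (2 * h\<^sup>2) + \<mu>\<^sup>2 / (2 * h\<^sup>2) + (h - \<mu>)\<^sup>2 / (2 * h\<^sup>2) = 1"
    using \<open>h \<noteq> 0\<close> by (simp flip: add_divide_distrib)
  finally show ?thesis by simp
qed

theorem mainTheorem1:
  fixes D V A \<rho> h \<mu> L :: real
    and N k :: nat
    and x \<tau> :: "nat \<Rightarrow> real"
    and f :: "real \<Rightarrow> real \<Rightarrow> real"
    and u :: "nat \<Rightarrow> real \<Rightarrow> real"
  assumes "D > 0" and "V \<noteq> 0" and "\<rho> > 0" and "h > 0" and "0 < \<mu>" and "\<mu> < h"
    and "shifted_grids L N h \<mu> x \<tau>"
    and "rho1 D V A \<mu> > 0" and "rho2 D V A h \<mu> > 0"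
    and "\<rho> > max (rho1 D V A \<mu>) (rho2 D V A h \<mu>)"
    and "A > 0 \<longrightarrow> \<rho> \<le> 1 / A"
  shows "monotone_scheme (shifted_grid_scheme D V A \<rho> h \<mu> N x f u k)"
proof -
  let ?S = "shifted_grid_scheme D V A \<rho> h \<mu> N x f u k"
  have h: "h \<noteq> 0" using \<open>h > 0\<close> by simp
  have "coeff_lower ?S > 0"
    using off_diagonal_coeff_pos[of \<rho> h \<mu> "D + V * \<mu>" A] assms(3,8,10) h
    by (simp add: shifted_grid_scheme_def rho1_def conv_a_eq)
  moreover have "coeff_upper ?S > 0"
    using off_diagonal_coeff_pos[of \<rho> h "h - \<mu>" "D + V * \<mu> - V * h" A] assms(3,9,10) h
    by (simp add: shifted_grid_scheme_def rho2_def conv_b_eq)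
  \<comment> \<open>This is what diagonal dominance amounts to. For \<open>A > 0\<close> it is the
    upper bound on \<rho> rearranged; otherwise \<open>1 / \<rho>\<close> is positive and A is
    not.\<close>
  moreover have "A \<le> 1 / \<rho>"
  proof (cases "A > 0")
    case True
    then show ?thesis using assms(3,11) by (simp add: field_simps)
  next
    case False
    moreover have "0 < 1 / \<rho>" using \<open>\<rho> > 0\<close> by simp
    ultimately show ?thesis by linarith
  qed
  then have "coeff_centre ?S \<ge> coeff_lower ?S + coeff_upper ?S"
    using shifted_grid_scheme_dominance[OF h refl, of D V A \<rho> \<mu> N x f u k] by linarith
  ultimately show ?thesis by (simp add: monotone_scheme_def)
qed

end
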